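(* Let $p$ and $q$ be distinct primes with $pq\neq 6$ and $q\mid p-1$. Let $r$ be an integer with $r^{q}\equiv 1 \pmod{p}$ and $r\not\equiv 1\pmod{p}$, and let $G=\langle a,b,c,d\mid a^{q}=b^{q}=c^{p}=d^{p}=[a,b]=[a,d]=[b,c]=[c,d]=1,\ a^{-1}ca=c^{r},\ b^{-1}db=d^{r}\rangle$. Then $\mathrm{Aut}(G)\simeq(\mathbb{Z}_{p}\times\mathbb{Z}_{p})\rtimes((\mathbb{Z}_{p-1}\times\mathbb{Z}_{p-1})\rtimes\mathbb{Z}_{2})$.
   Context: $\mathbb{Z}_n$ is the cyclic group of order $n$; $[x,y]=x^{-1}y^{-1}xy$. $X\rtimes Y$ denotes a semidirect product with normal subgroup $X$ with respect to some homomorphism $Y\to\mathrm{Aut}(X)$; the statement asserts that $\mathrm{Aut}(G)$ is isomorphic to such an (iterated) semidirect product for some choice of actions. *)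

theory Defs
  imports
    "HOL-Algebra.Bij"
    "HOL-Algebra.Coset"
    "HOL-Algebra.Elementary_Groups"
    "HOL-Number_Theory.Cong"
    "HOL-Computational_Algebra.Primes"
begin

section \<open>Free groups\<close>

text \<open>A letter \<open>(x, True)\<close> stands for the generator \<open>x\<close>, and \<open>(x, False)\<close> for its formal inverse.
  The free group on the type \<open>'g\<close> consists of the freely reduced words.\<close>

type_synonym 'g word = "('g \<times> bool) list"

definition opposite :: "'g \<times> bool \<Rightarrow> 'g \<times> bool \<Rightarrow> bool" where
  "opposite x y \<longleftrightarrow> fst x = fst y \<and> snd x \<noteq> snd y"

definition reduced :: "'g word \<Rightarrow> bool" where
  "reduced w \<longleftrightarrow> successively (\<lambda>x y. \<not> opposite x y) w"

fun push :: "'g \<times> bool \<Rightarrow> 'g word \<Rightarrow> 'g word" where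
  "push x [] = [x]"
| "push x (y # w) = (if opposite x y then w else x # y # w)"

definition free_group :: "'g word monoid" where
  "free_group = \<lparr>carrier = {w. reduced w}, monoid.mult = (\<lambda>u v. foldr push u v), one = []\<rparr>"

definition free_gen :: "'g \<Rightarrow> 'g word" where
  "free_gen x = [(x, True)]"

lemma reduced_Nil: "reduced []"
  by (simp add: reduced_def)

lemma reduced_ConsD: "reduced (x # w) \<Longrightarrow> reduced w"
  by (cases w) (auto simp: reduced_def)

lemma reduced_push: "reduced w \<Longrightarrow> reduced (push x w)"
  by (cases w) (auto simp: reduced_def dest: reduced_ConsD[unfolded reduced_def])

lemma reduced_foldr_push: "reduced v \<Longrightarrow> reduced (foldr push u v)"
  by (induction u) (auto intro: reduced_push)

lemma push_push_opposite:
  assumes "reduced w" "opposite x y"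
  shows "push x (push y w) = w"
proof (cases w)
  case Nil
  then show ?thesis using assms by simp
next
  case (Cons z w')
  show ?thesis
  proof (cases "opposite y z")
    case True
    then have "z = x" using assms(2) by (auto simp: opposite_def prod_eq_iff)
    then show ?thesis using Cons True assms(1) by (cases w') (auto simp: reduced_def)
  next
    case False
    then show ?thesis using Cons assms by simp
  qed
qed

lemma foldr_push_push:
  assumes "reduced w"
  shows "foldr push (push x v) w = push x (foldr push v w)"
  using assms by (cases v) (auto simp: push_push_opposite reduced_foldr_push)

lemma foldr_push_assoc:
  assumes "reduced w"
  shows "foldr push (foldr push u v) w = foldr push u (foldr push v w)"
  using assms by (induction u) (auto simp: foldr_push_push)

lemma foldr_push_Nil: "reduced u \<Longrightarrow> foldr push u [] = u"
proof (induction u)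
  case (Cons x u)
  then show ?case by (cases u) (auto simp: reduced_def)
qed simp

lemma foldr_push_inverse:
  assumes "reduced w"
  shows "foldr push (rev (map (\<lambda>x. (fst x, \<not> snd x)) u)) (foldr push u w) = w"
  using assms
proof (induction u)
  case (Cons x u)
  then show ?case by (simp add: push_push_opposite reduced_foldr_push opposite_def)
qed simp

lemma group_free_group: "group (free_group :: 'g word monoid)"
proof (rule groupI)
  fix u :: "'g word"
  assume "u \<in> carrier free_group"
  then have u: "reduced u" by (simp add: free_group_def)
  let ?v = "foldr push (rev (map (\<lambda>x. (fst x, \<not> snd x)) u)) []"
  have "foldr push ?v u = foldr push (rev (map (\<lambda>x. (fst x, \<not> snd x)) u)) (foldr push u [])"
    using u by (simp add: foldr_push_assoc foldr_push_Nil)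
  also have "\<dots> = []" by (rule foldr_push_inverse[OF reduced_Nil])
  finally show "\<exists>v\<in>carrier free_group. v \<otimes>\<^bsub>free_group\<^esub> u = \<one>\<^bsub>free_group\<^esub>"
    by (intro bexI[of _ ?v]) (auto simp: free_group_def reduced_foldr_push reduced_Nil)
qed (auto simp: free_group_def reduced_Nil reduced_foldr_push foldr_push_assoc)

lemma free_gen_closed: "free_gen x \<in> carrier free_group"
  by (simp add: free_group_def free_gen_def reduced_def)

section \<open>Groups given by generators and relations\<close>

definition normal_closure :: "('a, 'b) monoid_scheme \<Rightarrow> 'a set \<Rightarrow> 'a set" where
  "normal_closure G R = \<Inter>{N. N \<lhd> G \<and> R \<subseteq> N}"

text \<open>A pair \<open>(u, v)\<close> in \<open>E\<close> stands for the relation \<open>u = v\<close>.\<close>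

definition presented_group :: "('g word \<times> 'g word) set \<Rightarrow> 'g word set monoid" where
  "presented_group E = free_group Mod
     normal_closure free_group {u \<otimes>\<^bsub>free_group\<^esub> inv\<^bsub>free_group\<^esub> v | u v. (u, v) \<in> E}"

lemma normal_normal_closure:
  assumes "group G" "R \<subseteq> carrier G"
  shows "normal_closure G R \<lhd> G"
proof -
  interpret group G by fact
  have c: "carrier G \<in> {N. N \<lhd> G \<and> R \<subseteq> N}"
    using assms(2) by (auto simp: normal_inv_iff subgroup_self)
  show ?thesis
    unfolding normal_closure_def
  proof (intro normal_inv_iff[THEN iffD2] conjI ballI)
    show "subgroup (\<Inter>{N. N \<lhd> G \<and> R \<subseteq> N}) G"
      using c by (intro subgroups_Inter) (auto simp: normal_inv_iff)
  next
    fix x h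
    assume "x \<in> carrier G" "h \<in> \<Inter>{N. N \<lhd> G \<and> R \<subseteq> N}"
    then show "x \<otimes>\<^bsub>G\<^esub> h \<otimes>\<^bsub>G\<^esub> inv\<^bsub>G\<^esub> x \<in> \<Inter>{N. N \<lhd> G \<and> R \<subseteq> N}"
      by (auto simp: normal_inv_iff)
  qed
qed

lemma group_presented_group:
  assumes "E \<subseteq> carrier free_group \<times> carrier free_group"
  shows "group (presented_group E)"
proof -
  interpret F: group "free_group :: 'a word monoid" by (rule group_free_group)
  show ?thesis
    unfolding presented_group_def
    using assms
    by (intro normal.factorgroup_is_group[OF normal_normal_closure[OF group_free_group]]) fastforce
qed

section \<open>Semidirect products\<close>

text \<open>The normal factor is \<open>X\<close>, and \<open>\<phi>\<close> is meant to be a homomorphism from \<open>Y\<close> to the automorphism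
  group of \<open>X\<close>.\<close>

definition semidirect ::
  "('a, 'm) monoid_scheme \<Rightarrow> ('b, 'n) monoid_scheme \<Rightarrow> ('b \<Rightarrow> 'a \<Rightarrow> 'a) \<Rightarrow> ('a \<times> 'b) monoid" where
  "semidirect X Y \<phi> =
    \<lparr>carrier = carrier X \<times> carrier Y,
     monoid.mult = (\<lambda>(x, y) (x', y'). (x \<otimes>\<^bsub>X\<^esub> \<phi> y x', y \<otimes>\<^bsub>Y\<^esub> y')),
     one = (\<one>\<^bsub>X\<^esub>, \<one>\<^bsub>Y\<^esub>)\<rparr>"

lemma group_semidirect:
  assumes X: "group X" and Y: "group Y" and \<phi>: "\<phi> \<in> hom Y (AutoGroup X)"
  shows "group (semidirect X Y \<phi>)"
proof -
  interpret X: group X by fact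
  interpret Y: group Y by fact
  interpret A: group "AutoGroup X" by (rule X.AutoGroup)
  interpret h: group_hom Y "AutoGroup X" \<phi>
    using \<phi> by unfold_locales
  note h.hom_inv [simp del] h.hom_mult [simp del] h.hom_one [simp del]
  have aut: "\<phi> y \<in> auto X" if "y \<in> carrier Y" for y
    using h.hom_closed[OF that] by (simp add: AutoGroup_def)
  have cl: "\<phi> y x \<in> carrier X" if "y \<in> carrier Y" "x \<in> carrier X" for x y
    using aut[OF that(1)] that(2) by (auto simp: auto_def hom_def)
  have mul: "\<phi> y (x \<otimes>\<^bsub>X\<^esub> x') = \<phi> y x \<otimes>\<^bsub>X\<^esub> \<phi> y x'"
    if "y \<in> carrier Y" "x \<in> carrier X" "x' \<in> carrier X" for x x' y
    using aut[OF that(1)] that(2,3) by (auto simp: auto_def hom_def)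
  have act: "\<phi> (y \<otimes>\<^bsub>Y\<^esub> y') x = \<phi> y (\<phi> y' x)"
    if "y \<in> carrier Y" "y' \<in> carrier Y" "x \<in> carrier X" for x y y'
    using h.hom_mult[OF that(1,2)] aut[OF that(1)] aut[OF that(2)] that(3)
    by (simp add: AutoGroup_def BijGroup_def auto_def compose_def)
  have one: "\<phi> \<one>\<^bsub>Y\<^esub> x = x" if "x \<in> carrier X" for x
    using h.hom_one that by (simp add: AutoGroup_def BijGroup_def)
  show ?thesis
  proof (rule groupI)
    fix z
    assume "z \<in> carrier (semidirect X Y \<phi>)"
    then obtain x y where z: "z = (x, y)" "x \<in> carrier X" "y \<in> carrier Y"
      by (auto simp: semidirect_def)
    have "\<phi> (inv\<^bsub>Y\<^esub> y) (inv\<^bsub>X\<^esub> x) \<otimes>\<^bsub>X\<^esub> \<phi> (inv\<^bsub>Y\<^esub> y) x = \<phi> (inv\<^bsub>Y\<^esub> y) \<one>\<^bsub>X\<^esub>"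
      using z mul[of "inv\<^bsub>Y\<^esub> y" "inv\<^bsub>X\<^esub> x" x] by simp
    moreover have "\<phi> (inv\<^bsub>Y\<^esub> y) \<one>\<^bsub>X\<^esub> = \<one>\<^bsub>X\<^esub>"
      using z cl mul[of "inv\<^bsub>Y\<^esub> y" "\<one>\<^bsub>X\<^esub>" "\<one>\<^bsub>X\<^esub>"] by simp
    ultimately show "\<exists>w\<in>carrier (semidirect X Y \<phi>).
        w \<otimes>\<^bsub>semidirect X Y \<phi>\<^esub> z = \<one>\<^bsub>semidirect X Y \<phi>\<^esub>"
      using z cl by (intro bexI[of _ "(\<phi> (inv\<^bsub>Y\<^esub> y) (inv\<^bsub>X\<^esub> x), inv\<^bsub>Y\<^esub> y)"]) (auto simp: semidirect_def)
  qed (auto simp: semidirect_def cl mul act one X.m_assoc Y.m_assoc)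
qed

section \<open>The group of the statement\<close>

datatype gen = GenA | GenB | GenC | GenD

definition commutator :: "('a, 'b) monoid_scheme \<Rightarrow> 'a \<Rightarrow> 'a \<Rightarrow> 'a" where
  "commutator G x y = inv\<^bsub>G\<^esub> x \<otimes>\<^bsub>G\<^esub> inv\<^bsub>G\<^esub> y \<otimes>\<^bsub>G\<^esub> x \<otimes>\<^bsub>G\<^esub> y"

definition relations :: "nat \<Rightarrow> nat \<Rightarrow> int \<Rightarrow> (gen word \<times> gen word) set" where
  "relations p q r =
    (let F = free_group;
         a = free_gen GenA; b = free_gen GenB; c = free_gen GenC; d = free_gen GenD
     in {(a [^]\<^bsub>F\<^esub> q, \<one>\<^bsub>F\<^esub>), (b [^]\<^bsub>F\<^esub> q, \<one>\<^bsub>F\<^esub>), (c [^]\<^bsub>F\<^esub> p, \<one>\<^bsub>F\<^esub>), (d [^]\<^bsub>F\<^esub> p, \<one>\<^bsub>F\<^esub>),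
         (commutator F a b, \<one>\<^bsub>F\<^esub>), (commutator F a d, \<one>\<^bsub>F\<^esub>),
         (commutator F b c, \<one>\<^bsub>F\<^esub>), (commutator F c d, \<one>\<^bsub>F\<^esub>),
         (inv\<^bsub>F\<^esub> a \<otimes>\<^bsub>F\<^esub> c \<otimes>\<^bsub>F\<^esub> a, c [^]\<^bsub>F\<^esub> r),
         (inv\<^bsub>F\<^esub> b \<otimes>\<^bsub>F\<^esub> d \<otimes>\<^bsub>F\<^esub> b, d [^]\<^bsub>F\<^esub> r)})"

end

theory Submission
  imports Defs "HOL-Number_Theory.Residue_Primitive_Roots"
begin

text \<open>
  The group \<open>G\<close> is the square \<open>H \<times> H\<close> of the Frobenius group \<open>H\<close> of order \<open>p q\<close>, with \<open>a\<close>, \<open>c\<close> generating one factor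
  and \<open>b\<close>, \<open>d\<close> the other. The group \<open>H\<close> is a normal subgroup of the group \<open>AGL(1,p)\<close> of affine maps of the line over
  \<open>\<int>/p\<close>, with \<open>c\<close> a translation and \<open>a\<close> a scaling, and every automorphism of \<open>H\<close> is the restriction of a unique
  conjugation by an affine map. An automorphism of \<open>H \<times> H\<close> may in addition exchange the two factors, so
  \<open>Aut(G)\<close> is the wreath product of \<open>AGL(1,p)\<close> with \<open>\<int>\<^sub>2\<close>. Writing its elements as a pair of translations, a pair of
  scalings (each a power of a primitive root) and an exchange gives the iterated semidirect product of the claim.

  The proof takes this semidirect product \<open>W\<close> as the ambient group. Its elements are handled as affine maps
  \<open>T u v s t\<close> and the exchange \<open>\<sigma>\<close>, and the presented group is mapped to \<open>W\<close> by its universal property. The relations bring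
  every element into the form \<open>a^i b^j c^x d^y\<close> (\<open>normal_form\<close>), and comparing exponents shows that the map to \<open>W\<close>
  is injective (\<open>\<theta>_inj\<close>). By \<open>AutoGroup_iso_normalizer\<close> it remains to see that the image is normal, has
  trivial centralizer, and that every automorphism is induced by conjugation in \<open>W\<close>. The last point is
  \<open>auto_conjugate\<close>: the defining relations, read in \<open>W\<close>, force the images of \<open>a\<close>, \<open>b\<close>, \<open>c\<close>, \<open>d\<close> under an automorphism to be, up to
  the exchange, two scalings about some point and two translations along the axes, and an affine change of coordinates
  takes these to the standard generators.
\<close>

section \<open>Automorphisms induced from a larger group\<close>

lemma action_hom_AutoGroup:
  assumes X: "group X" and Y: "group Y"
    and ext: "\<And>y. y \<in> carrier Y \<Longrightarrow> F y \<in> extensional (carrier X)"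
    and hom: "\<And>y. y \<in> carrier Y \<Longrightarrow> F y \<in> hom X X"
    and one: "\<And>x. x \<in> carrier X \<Longrightarrow> F \<one>\<^bsub>Y\<^esub> x = x"
    and mult: "\<And>y y' x. y \<in> carrier Y \<Longrightarrow> y' \<in> carrier Y \<Longrightarrow> x \<in> carrier X \<Longrightarrow> F (y \<otimes>\<^bsub>Y\<^esub> y') x = F y (F y' x)"
  shows "F \<in> hom Y (AutoGroup X)"
proof -
  interpret X: group X by fact
  interpret Y: group Y by fact
  have F_auto: "F y \<in> auto X" if y: "y \<in> carrier Y" for y
  proof -
    have "bij_betw (F y) (carrier X) (carrier X)"
      using y hom[OF y] hom[of "inv\<^bsub>Y\<^esub> y"] mult[of y "inv\<^bsub>Y\<^esub> y"] mult[of "inv\<^bsub>Y\<^esub> y" y] one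
      by (intro bij_betw_byWitness[where f' = "F (inv\<^bsub>Y\<^esub> y)"]) (auto dest: hom_in_carrier)
    then show ?thesis
      using ext[OF y] hom[OF y] by (simp add: auto_def Bij_def)
  qed
  show ?thesis
  proof (rule homI)
    fix y y' assume y: "y \<in> carrier Y" "y' \<in> carrier Y"
    have "F (y \<otimes>\<^bsub>Y\<^esub> y') = compose (carrier X) (F y) (F y')"
      using y by (intro extensionalityI[of _ "carrier X"]) (auto simp: ext mult compose_def)
    then show "F (y \<otimes>\<^bsub>Y\<^esub> y') = F y \<otimes>\<^bsub>AutoGroup X\<^esub> F y'"
      using F_auto y by (simp add: AutoGroup_def BijGroup_def auto_def)
  qed (simp add: AutoGroup_def F_auto)
qed

text \<open>If \<open>P\<close> sits in \<open>W\<close> as a normal subgroup, conjugation maps \<open>W\<close> to \<open>Aut(P)\<close>. The kernel of this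
  map is the centralizer of \<open>P\<close>, so a trivial centralizer makes it injective, and surjectivity is the
  requirement that every automorphism be realized by conjugation. The realization is written as
  \<open>\<theta> (f x) w = w \<theta> x\<close> so that in applications it can be checked without computing inverses.\<close>

lemma AutoGroup_iso_normalizer:
  assumes P: "group P" and W: "group W"
    and hom: "\<theta> \<in> hom P W" and inj: "inj_on \<theta> (carrier P)"
    and nrm: "\<And>w x. w \<in> carrier W \<Longrightarrow> x \<in> carrier P \<Longrightarrow> w \<otimes>\<^bsub>W\<^esub> \<theta> x \<otimes>\<^bsub>W\<^esub> inv\<^bsub>W\<^esub> w \<in> \<theta> ` carrier P"
    and cent: "\<And>w. w \<in> carrier W \<Longrightarrow> (\<And>x. x \<in> carrier P \<Longrightarrow> w \<otimes>\<^bsub>W\<^esub> \<theta> x = \<theta> x \<otimes>\<^bsub>W\<^esub> w) \<Longrightarrow> w = \<one>\<^bsub>W\<^esub>"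
    and inner: "\<And>f. f \<in> auto P \<Longrightarrow> \<exists>w\<in>carrier W. \<forall>x\<in>carrier P. \<theta> (f x) \<otimes>\<^bsub>W\<^esub> w = w \<otimes>\<^bsub>W\<^esub> \<theta> x"
  shows "AutoGroup P \<cong> W"
proof -
  interpret P: group P by fact
  interpret W: group W by fact
  interpret h: group_hom P W \<theta> using hom by unfold_locales
  note h.hom_inv [simp del] h.hom_mult [simp del] h.hom_one [simp del]
  have \<theta>_eqD: "x = y" if "\<theta> x = \<theta> y" "x \<in> carrier P" "y \<in> carrier P" for x y
    using inj that by (auto dest: inj_onD)
  have cancel: "inv\<^bsub>W\<^esub> w \<otimes>\<^bsub>W\<^esub> (w \<otimes>\<^bsub>W\<^esub> z) = z" if "w \<in> carrier W" "z \<in> carrier W" for w z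
    using that by (simp add: W.m_assoc[symmetric])
  define C where "C w = (\<lambda>x\<in>carrier P. inv_into (carrier P) \<theta> (w \<otimes>\<^bsub>W\<^esub> \<theta> x \<otimes>\<^bsub>W\<^esub> inv\<^bsub>W\<^esub> w))" for w
  have C_closed: "C w x \<in> carrier P" and \<theta>_C: "\<theta> (C w x) = w \<otimes>\<^bsub>W\<^esub> \<theta> x \<otimes>\<^bsub>W\<^esub> inv\<^bsub>W\<^esub> w"
    if "w \<in> carrier W" "x \<in> carrier P" for w x
    using nrm[OF that] that by (auto simp: C_def inv_into_into f_inv_into_f)
  have C_one: "C \<one>\<^bsub>W\<^esub> x = x" if "x \<in> carrier P" for x
    by (rule \<theta>_eqD) (use that in \<open>simp_all add: \<theta>_C C_closed\<close>)
  have C_mult: "C (w \<otimes>\<^bsub>W\<^esub> w') x = C w (C w' x)"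
    if "w \<in> carrier W" "w' \<in> carrier W" "x \<in> carrier P" for w w' x
    by (rule \<theta>_eqD) (use that in \<open>simp_all add: \<theta>_C C_closed W.m_assoc W.inv_mult_group\<close>)
  have C_hom: "C w (x \<otimes>\<^bsub>P\<^esub> y) = C w x \<otimes>\<^bsub>P\<^esub> C w y"
    if "w \<in> carrier W" "x \<in> carrier P" "y \<in> carrier P" for w x y
  proof (rule \<theta>_eqD)
    show "\<theta> (C w (x \<otimes>\<^bsub>P\<^esub> y)) = \<theta> (C w x \<otimes>\<^bsub>P\<^esub> C w y)"
      using that by (simp add: \<theta>_C C_closed h.hom_mult W.m_assoc cancel)
  qed (use that in \<open>simp_all add: C_closed\<close>)
  have C_inv: "C w (C (inv\<^bsub>W\<^esub> w) x) = x" "C (inv\<^bsub>W\<^esub> w) (C w x) = x"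
    if "w \<in> carrier W" "x \<in> carrier P" for w x
    using C_mult[of w "inv\<^bsub>W\<^esub> w" x] C_mult[of "inv\<^bsub>W\<^esub> w" w x] that by (simp_all add: C_one)
  have hom_C: "C \<in> hom W (AutoGroup P)"
    by (rule action_hom_AutoGroup)
      (auto simp: C_closed C_hom C_one C_mult intro!: homI, simp add: C_def)
  have "C \<in> iso W (AutoGroup P)"
    unfolding iso_iff
  proof (intro conjI)
    show "C \<in> hom W (AutoGroup P)" by (rule hom_C)
    show "C ` carrier W = carrier (AutoGroup P)"
    proof (intro equalityI subsetI)
      fix f assume "f \<in> carrier (AutoGroup P)"
      then have f: "f \<in> auto P" by (simp add: AutoGroup_def)
      then obtain w where w: "w \<in> carrier W" "\<And>x. x \<in> carrier P \<Longrightarrow> \<theta> (f x) \<otimes>\<^bsub>W\<^esub> w = w \<otimes>\<^bsub>W\<^esub> \<theta> x"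
        using inner by blast
      have fc: "f x \<in> carrier P" if "x \<in> carrier P" for x
        using f that by (auto simp: auto_def hom_def)
      have "C w x = f x" if "x \<in> carrier P" for x
        by (rule \<theta>_eqD) (use that w fc in \<open>simp_all add: \<theta>_C C_closed W.inv_solve_right' flip: w(2)\<close>)
      then have "C w = f"
        using f by (intro extensionalityI[of _ "carrier P"]) (auto simp: C_def auto_def Bij_def)
      then show "f \<in> C ` carrier W" using w(1) by blast
    qed (use hom_C in \<open>auto dest: hom_in_carrier\<close>)
    show "inj_on C (carrier W)"
    proof (rule inj_onI)
      fix w w' assume w: "w \<in> carrier W" "w' \<in> carrier W" and eq: "C w = C w'"
      have "inv\<^bsub>W\<^esub> w' \<otimes>\<^bsub>W\<^esub> w = \<one>\<^bsub>W\<^esub>"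
      proof (rule cent)
        fix x assume x: "x \<in> carrier P"
        have "C (inv\<^bsub>W\<^esub> w' \<otimes>\<^bsub>W\<^esub> w) x = x"
          using w x eq by (simp add: C_mult C_inv)
        then show "inv\<^bsub>W\<^esub> w' \<otimes>\<^bsub>W\<^esub> w \<otimes>\<^bsub>W\<^esub> \<theta> x = \<theta> x \<otimes>\<^bsub>W\<^esub> (inv\<^bsub>W\<^esub> w' \<otimes>\<^bsub>W\<^esub> w)"
          using \<theta>_C[of "inv\<^bsub>W\<^esub> w' \<otimes>\<^bsub>W\<^esub> w" x] w x
          by (simp add: W.inv_solve_right)
      qed (use w in simp)
      then show "w = w'"
        using w by (metis W.inv_closed W.inv_equality W.inv_inv)
    qed
  qed
  then have "W \<cong> AutoGroup P" by (auto simp: is_iso_def)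
  then show ?thesis by (rule W.iso_sym)
qed

section \<open>The group of affine maps in two variables\<close>

definition swap_if :: "int \<Rightarrow> 'a \<times> 'a \<Rightarrow> 'a \<times> 'a" where
  "swap_if e z = (if e = 0 then z else prod.swap z)"

text \<open>The map \<open>E\<close> plays the role of \<open>s \<mapsto> g^s\<close> for a primitive root \<open>g\<close> modulo \<open>p\<close>: it identifies the
  additive group \<open>\<int>/(p - 1)\<close> with the multiplicative group of units modulo \<open>p\<close>. Through it,
  the exponent groups of the target act by multiplication.\<close>

locale discrete_exponential =
  fixes p :: nat and E :: "int \<Rightarrow> int"
  assumes prime_p: "prime p" and p_gt_2: "p > 2"
    and E_0 [simp]: "E 0 = 1"
    and E_add: "[E (s + t) = E s * E t] (mod int p)"
    and E_cong_1_iff: "[E s = 1] (mod int p) \<longleftrightarrow> [s = 0] (mod (int p - 1))"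
    and E_surj: "\<not> int p dvd u \<Longrightarrow> \<exists>s. [E s = u] (mod int p)"
begin

lemma E_cong_iff: "[E s = E t] (mod int p) \<longleftrightarrow> [s = t] (mod (int p - 1))"
proof
  assume "[E s = E t] (mod int p)"
  have "[E (s - t) = E s * E (- t)] (mod int p)"
    using E_add[of s "- t"] by simp
  also have "[E s * E (- t) = E t * E (- t)] (mod int p)"
    by (rule cong_scalar_right) fact
  also have "[E t * E (- t) = E 0] (mod int p)"
    using E_add[of t "- t"] by (simp add: cong_sym_eq)
  finally have "[s - t = 0] (mod (int p - 1))"
    by (simp flip: E_cong_1_iff)
  then show "[s = t] (mod (int p - 1))"
    by (simp add: cong_iff_dvd_diff)
next
  assume "[s = t] (mod (int p - 1))"
  then have "[s - t = 0] (mod (int p - 1))"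
    by (simp add: cong_iff_dvd_diff)
  then have "[E (s - t) = 1] (mod int p)"
    by (simp only: E_cong_1_iff)
  then have "[E (s - t) * E t = 1 * E t] (mod int p)"
    by (rule cong_scalar_right)
  with E_add[of "s - t" t] show "[E s = E t] (mod int p)"
    by (auto intro: cong_trans)
qed

lemma E_mod: "[E (s mod (int p - 1)) = E s] (mod int p)"
  by (simp add: E_cong_iff)

lemma E_uminus: "[E s * E (- s) = 1] (mod int p)"
  using E_add[of s "- s"] by (simp add: cong_sym_eq)

lemma E_not_dvd: "\<not> int p dvd E s"
proof
  assume "int p dvd E s"
  then have "[E s * E (- s) = 0] (mod int p)"
    by (simp add: cong_0_iff)
  then have "[1 = 0] (mod int p)"
    using E_uminus cong_trans cong_sym by blast
  then show False using p_gt_2 by (auto simp: cong_0_iff)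
qed

lemma E_pow:
  assumes "[E k * r = 1] (mod int p)"
  shows "[E (int n * k) * r ^ n = 1] (mod int p)"
proof (induction n)
  case (Suc n)
  have "[E (int (Suc n) * k) * r ^ Suc n = (E (int n * k) * E k) * r ^ Suc n] (mod int p)"
    using E_add[of "int n * k" k] by (intro cong_scalar_right) (simp add: algebra_simps)
  also have "(E (int n * k) * E k) * r ^ Suc n = (E (int n * k) * r ^ n) * (E k * r)"
    by (simp add: algebra_simps)
  also have "[\<dots> = 1 * 1] (mod int p)"
    by (rule cong_mult[OF Suc assms])
  finally show ?case by simp
qed simp

definition shifts :: "(int \<times> int) monoid" where
  "shifts = integer_mod_group p \<times>\<times> integer_mod_group p"

definition exponents :: "(int \<times> int) monoid" where
  "exponents = integer_mod_group (p - 1) \<times>\<times> integer_mod_group (p - 1)"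

definition exchange :: "int \<Rightarrow> int \<times> int \<Rightarrow> int \<times> int" where
  "exchange e = restrict (swap_if e) (carrier exponents)"

definition monomials :: "((int \<times> int) \<times> int) monoid" where
  "monomials = semidirect exponents (integer_mod_group 2) exchange"

definition scale :: "(int \<times> int) \<times> int \<Rightarrow> int \<times> int \<Rightarrow> int \<times> int" where
  "scale = (\<lambda>((s, t), e). \<lambda>z\<in>carrier shifts.
     (E s * fst (swap_if e z) mod int p, E t * snd (swap_if e z) mod int p))"

text \<open>The target group \<open>W\<close> is the wreath product of \<open>AGL(1,p)\<close> with \<open>\<int>\<^sub>2\<close>: the translations, the scalings (given
  by their exponents) and the exchange of the two coordinates of \<open>(\<int>/p)\<^sup>2\<close>.\<close>

definition W :: "((int \<times> int) \<times> ((int \<times> int) \<times> int)) monoid" where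
  "W = semidirect shifts monomials scale"

lemma shifts_simps [simp]:
  "carrier shifts = {0..<int p} \<times> {0..<int p}"
  "(u, v) \<otimes>\<^bsub>shifts\<^esub> (u', v') = ((u + u') mod int p, (v + v') mod int p)"
  "\<one>\<^bsub>shifts\<^esub> = (0, 0)"
  using p_gt_2 by (auto simp: shifts_def carrier_integer_mod_group)

lemma exponents_simps [simp]:
  "carrier exponents = {0..<(int p - 1)} \<times> {0..<(int p - 1)}"
  "(u, v) \<otimes>\<^bsub>exponents\<^esub> (u', v') = ((u + u') mod (int p - 1), (v + v') mod (int p - 1))"
  "\<one>\<^bsub>exponents\<^esub> = (0, 0)"
  using p_gt_2 by (auto simp: exponents_def carrier_integer_mod_group)

lemma group_shifts: "group shifts"
  by (simp add: shifts_def DirProd_group)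

lemma group_exponents: "group exponents"
  by (simp add: exponents_def DirProd_group)

lemma carrier_Z2: "carrier (integer_mod_group 2) = {0, 1}"
  by (auto simp: carrier_integer_mod_group)

lemma exchange_hom: "exchange \<in> hom (integer_mod_group 2) (AutoGroup exponents)"
  by (rule action_hom_AutoGroup)
    (auto simp: group_exponents carrier_Z2 exchange_def swap_if_def intro!: homI)

lemma group_monomials: "group monomials"
  unfolding monomials_def
  by (rule group_semidirect[OF group_exponents group_integer_mod_group exchange_hom])

lemma monomials_simps:
  "carrier monomials = carrier exponents \<times> {0, 1}"
  "st \<in> carrier exponents \<Longrightarrow> st' \<in> carrier exponents \<Longrightarrow>
     (st, e) \<otimes>\<^bsub>monomials\<^esub> (st', e') = (st \<otimes>\<^bsub>exponents\<^esub> swap_if e st', (e + e') mod 2)"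
  "\<one>\<^bsub>monomials\<^esub> = ((0, 0), 0)"
  by (auto simp: monomials_def semidirect_def carrier_Z2 exchange_def)

lemma E_act: "E ((s + t) mod (int p - 1)) * x mod int p = E s * (E t * x) mod int p"
proof -
  have "[E ((s + t) mod (int p - 1)) * x = (E s * E t) * x] (mod int p)"
    using E_mod E_add by (intro cong_scalar_right) (rule cong_trans)
  then show ?thesis by (simp add: cong_def mult.assoc)
qed

lemma scale_hom: "scale \<in> hom monomials (AutoGroup shifts)"
proof (rule action_hom_AutoGroup)
  fix y assume y: "y \<in> carrier monomials"
  then show "scale y \<in> extensional (carrier shifts)"
    by (auto simp: scale_def split: prod.splits)
  show "scale y \<in> hom shifts shifts"
    using y p_gt_2
    by (intro homI) (auto simp: scale_def swap_if_def mod_simps distrib_left monomials_simps)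
next
  fix x assume "x \<in> carrier shifts"
  then show "scale \<one>\<^bsub>monomials\<^esub> x = x"
    by (auto simp: scale_def swap_if_def monomials_simps)
next
  fix y y' x
  assume "y \<in> carrier monomials" "y' \<in> carrier monomials" "x \<in> carrier shifts"
  then show "scale (y \<otimes>\<^bsub>monomials\<^esub> y') x = scale y (scale y' x)"
    using p_gt_2
    by (auto simp: scale_def monomials_simps swap_if_def mod_simps E_act)
qed (rule group_shifts group_monomials)+

sublocale W: group W
  unfolding W_def by (rule group_semidirect[OF group_shifts group_monomials scale_hom])

text \<open>\<open>T u v s t\<close> is the map \<open>(x, y) \<mapsto> (E s * x + u, E t * y + v)\<close>. Reducing all arguments inside the definition lets
  its multiplication law hold for arbitrary integers, and turns equations in \<open>W\<close> into congruences.
  Together with the exchange \<open>\<sigma>\<close> these elements give all of \<open>W\<close>, so later computations use only the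
  multiplication rules of \<open>T\<close> and \<open>\<sigma>\<close>.\<close>

definition T :: "int \<Rightarrow> int \<Rightarrow> int \<Rightarrow> int \<Rightarrow> (int \<times> int) \<times> ((int \<times> int) \<times> int)" where
  "T u v s t = ((u mod int p, v mod int p), ((s mod (int p - 1), t mod (int p - 1)), 0))"

definition \<sigma> :: "(int \<times> int) \<times> ((int \<times> int) \<times> int)" where
  "\<sigma> = ((0, 0), ((0, 0), 1))"

lemma T_eq_iff:
  "T u v s t = T u' v' s' t' \<longleftrightarrow> [u = u'] (mod int p) \<and> [v = v'] (mod int p) \<and>
     [s = s'] (mod (int p - 1)) \<and> [t = t'] (mod (int p - 1))"
  by (auto simp: T_def cong_def)

lemma W_one: "\<one>\<^bsub>W\<^esub> = T 0 0 0 0"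
  by (simp add: W_def semidirect_def T_def monomials_simps)

lemma T_closed [simp, intro]: "T u v s t \<in> carrier W"
  using p_gt_2 by (simp add: W_def semidirect_def T_def monomials_simps)

lemma \<sigma>_closed [simp, intro]: "\<sigma> \<in> carrier W"
  using p_gt_2 by (simp add: W_def semidirect_def \<sigma>_def monomials_simps)

lemma T_mult: "T u v s t \<otimes>\<^bsub>W\<^esub> T u' v' s' t' = T (u + E s * u') (v + E t * v') (s + s') (t + t')"
proof -
  have aux: "(u + E (s mod (int p - 1)) * u') mod int p = (u + E s * u') mod int p" for u u' s
    using cong_add[OF cong_refl E_mod[of s, THEN cong_scalar_right, of u'], of u]
    by (simp add: cong_def)
  show ?thesis
    using p_gt_2
    by (simp add: W_def semidirect_def T_def monomials_simps scale_def swap_if_def mod_simps aux)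
qed

lemma \<sigma>_T: "\<sigma> \<otimes>\<^bsub>W\<^esub> T u v s t = T v u t s \<otimes>\<^bsub>W\<^esub> \<sigma>"
  using p_gt_2
  by (simp add: W_def semidirect_def T_def \<sigma>_def monomials_simps scale_def swap_if_def)

lemma \<sigma>_\<sigma>: "\<sigma> \<otimes>\<^bsub>W\<^esub> \<sigma> = \<one>\<^bsub>W\<^esub>"
  using p_gt_2 by (simp add: W_def semidirect_def \<sigma>_def monomials_simps scale_def swap_if_def)

lemma W_cases:
  assumes "w \<in> carrier W"
  obtains u v s t where "w = T u v s t" | u v s t where "w = T u v s t \<otimes>\<^bsub>W\<^esub> \<sigma>"
proof -
  obtain u v s t e where w: "w = ((u, v), ((s, t), e))" by (metis surj_pair)
  have bounds: "u \<in> {0..<int p}" "v \<in> {0..<int p}" "s \<in> {0..<(int p - 1)}" "t \<in> {0..<(int p - 1)}"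
    "e = 0 \<or> e = 1"
    using assms by (auto simp: w W_def semidirect_def monomials_simps)
  show thesis
  proof (cases "e = 0")
    case True
    then show thesis using bounds by (intro that(1)[of u v s t]) (simp add: w T_def)
  next
    case False
    then have "w = T u v s t \<otimes>\<^bsub>W\<^esub> \<sigma>"
      using bounds p_gt_2
      by (simp add: w W_def semidirect_def T_def \<sigma>_def monomials_simps scale_def swap_if_def)
    then show thesis by (rule that(2))
  qed
qed

lemma T_inv: "inv\<^bsub>W\<^esub> T u v s t = T (- (E (- s) * u)) (- (E (- t) * v)) (- s) (- t)"
  by (rule W.inv_equality) (simp_all add: T_mult W_one)

lemma T_pow_shift: "T 0 0 s t [^]\<^bsub>W\<^esub> (n :: nat) = T 0 0 (int n * s) (int n * t)"
  by (induction n) (simp_all add: W_one T_mult algebra_simps)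

lemma T_pow_translation: "T u v 0 0 [^]\<^bsub>W\<^esub> (n :: nat) = T (int n * u) (int n * v) 0 0"
  by (induction n) (simp_all add: W_one T_mult algebra_simps)

lemma T_int_pow_translation: "T u v 0 0 [^]\<^bsub>W\<^esub> (n :: int) = T (n * u) (n * v) 0 0"
  by (simp add: int_pow_def2 T_pow_translation T_inv)

lemma T_pow_exponents: "\<exists>u' v'. T u v s t [^]\<^bsub>W\<^esub> (n :: nat) = T u' v' (int n * s) (int n * t)"
proof (induction n)
  case 0
  show ?case by (force simp: W_one)
next
  case (Suc n)
  then obtain u' v' where "T u v s t [^]\<^bsub>W\<^esub> n = T u' v' (int n * s) (int n * t)"
    by blast
  then have "T u v s t [^]\<^bsub>W\<^esub> Suc n =
      T (u' + E (int n * s) * u) (v' + E (int n * t) * v) (int (Suc n) * s) (int (Suc n) * t)"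
    by (simp add: T_mult algebra_simps)
  then show ?case by blast
qed

end

lemma exists_discrete_exponential:
  assumes "prime p" "p > 2"
  shows "\<exists>E. discrete_exponential p E"
proof -
  obtain g where g: "residue_primroot p g"
    using prime_primitive_root_exists[of p] assms by auto
  have cop: "coprime p g" and ord: "ord p g = p - 1"
    using g assms(1) by (auto simp: residue_primroot_def totient_prime)
  \<comment> \<open>Reducing \<open>s\<close> first makes \<open>E\<close> total on the integers and gives \<open>E 0 = 1\<close> exactly, not only modulo \<open>p\<close>.\<close>
  define E where "E s = int (g ^ nat (s mod (int p - 1)))" for s
  have m: "int p - 1 > 0" using assms by auto
  have pow_cong: "[int (g ^ nat i) = int (g ^ nat j)] (mod int p) \<longleftrightarrow> [i = j] (mod (int p - 1))"
    if "i \<ge> 0" "j \<ge> 0" for i j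
  proof -
    have "[int (g ^ nat i) = int (g ^ nat j)] (mod int p) \<longleftrightarrow> [nat i = nat j] (mod (p - 1))"
      unfolding cong_int_iff order_divides_expdiff[OF cop] ord ..
    also have "\<dots> \<longleftrightarrow> [i = j] (mod int (p - 1))"
      using that by (simp flip: cong_int_iff)
    also have "int (p - 1) = int p - 1" using assms by auto
    finally show ?thesis .
  qed
  have "discrete_exponential p E"
  proof
    show "[E (s + t) = E s * E t] (mod int p)" for s t
    proof -
      have "E s * E t = int (g ^ nat (s mod (int p - 1) + t mod (int p - 1)))"
        using m by (simp add: E_def nat_add_distrib power_add)
      then show ?thesis
        using m pow_cong[of "(s + t) mod (int p - 1)" "s mod (int p - 1) + t mod (int p - 1)"]
        by (simp add: E_def cong_def mod_simps)
    qed
    show "[E s = 1] (mod int p) \<longleftrightarrow> [s = 0] (mod (int p - 1))" for s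
      using m pow_cong[of "s mod (int p - 1)" 0] by (simp add: E_def)
    show "\<exists>s. [E s = u] (mod int p)" if "\<not> int p dvd u" for u
    proof -
      have "nat (u mod int p) \<in> totatives p"
        using that assms pos_mod_bound[of "int p" u] pos_mod_sign[of "int p" u]
        by (auto simp: totatives_prime dvd_eq_mod_eq_0 order_le_less nat_less_iff)
      then obtain i where "i < p - 1" "nat (u mod int p) = g ^ i mod p"
        using residue_primroot_is_generator[OF _ g] assms
        by (auto simp: bij_betw_def totient_prime)
      then have "[E (int i) = u] (mod int p)"
        using assms by (simp add: E_def cong_def nat_eq_iff of_nat_mod)
      then show ?thesis by blast
    qed
  qed (use assms in \<open>simp_all add: E_def\<close>)
  then show ?thesis by blast
qed

section \<open>The automorphisms of the square of a Frobenius group\<close>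

text \<open>The defining relations of the group, in the form in which they are used, with a homomorphism to \<open>W\<close>
  sending \<open>c\<close>, \<open>d\<close> to the unit translations and \<open>a\<close>, \<open>b\<close> to the scalings by \<open>E k\<close>. The law of \<open>W\<close> turns \<open>c a = a c^r\<close>
  into \<open>E k * r = 1\<close>, so that \<open>E k\<close> has to be the inverse of \<open>r\<close>.\<close>

locale embedded_square = discrete_exponential p E + P: group P
  for p E and P (structure) +
  fixes q r :: nat and k :: int and a b c d and \<theta>
  assumes prime_q: "prime q" and r_pow_q: "[r ^ q = 1] (mod p)" and r_neq_1: "\<not> [r = 1] (mod p)"
    and E_k_r: "[E k * int r = 1] (mod int p)"
    and gens_closed [simp]: "a \<in> carrier P" "b \<in> carrier P" "c \<in> carrier P" "d \<in> carrier P"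
    and generated: "carrier P = generate P {a, b, c, d}"
    and pow_gens: "a [^] q = \<one>" "b [^] q = \<one>" "c [^] p = \<one>" "d [^] p = \<one>"
    and comm_gens: "a \<otimes> b = b \<otimes> a" "a \<otimes> d = d \<otimes> a" "b \<otimes> c = c \<otimes> b" "c \<otimes> d = d \<otimes> c"
    and twist: "c \<otimes> a = a \<otimes> c [^] r" "d \<otimes> b = b \<otimes> d [^] r"
    and \<theta>_hom: "\<theta> \<in> hom P W"
    and \<theta>_gens: "\<theta> a = T 0 0 k 0" "\<theta> b = T 0 0 0 k" "\<theta> c = T 1 0 0 0" "\<theta> d = T 0 1 0 0"
begin

lemma twist_pow:
  assumes "x \<in> carrier P" "y \<in> carrier P" "y \<otimes> x = x \<otimes> y [^] r"
  shows "y [^] (n :: nat) \<otimes> x = x \<otimes> y [^] (r * n)"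
proof (induction n)
  case (Suc n)
  have "y [^] Suc n \<otimes> x = (y [^] n \<otimes> x) \<otimes> y [^] r"
    using assms by (simp add: P.m_assoc)
  also have "\<dots> = x \<otimes> y [^] (r * Suc n)"
    using assms Suc by (simp add: P.m_assoc P.nat_pow_mult add.commute)
  finally show ?case .
qed (use assms in simp)

text \<open>Multiplying a product \<open>a^i b^j c^x d^y\<close> from the right by a generator gives such a product again, since
  \<open>c\<close> and \<open>d\<close> can be moved past \<open>a\<close> and \<open>b\<close> at the cost of a factor \<open>r\<close> in the exponent. Inverses of the generators
  are powers of them, which keeps all exponents in the natural numbers.\<close>

lemma normal_form:
  assumes "z \<in> carrier P"
  obtains i j x y :: nat where "z = a [^] i \<otimes> b [^] j \<otimes> c [^] x \<otimes> d [^] y"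
proof -
  \<comment> \<open>\<open>M\<close> is a submonoid, so it suffices that it contains the generators and that they have finite order.\<close>
  define S where "S = {a [^] i \<otimes> b [^] j \<otimes> c [^] x \<otimes> d [^] y | (i :: nat) (j :: nat) (x :: nat) (y :: nat). True}"
  define M where "M = {z \<in> carrier P. \<forall>s\<in>S. s \<otimes> z \<in> S}"
  have SI: "a [^] i \<otimes> b [^] j \<otimes> c [^] x \<otimes> d [^] y \<in> S" for i j x y :: nat
    unfolding S_def by blast
  have S_closed: "S \<subseteq> carrier P" by (auto simp: S_def)
  have M_mult: "z \<otimes> z' \<in> M" if "z \<in> M" "z' \<in> M" for z z'
    using that S_closed by (auto simp: M_def simp flip: P.m_assoc)
  have M_one: "\<one> \<in> M" using S_closed by (auto simp: M_def)
  have M_pow: "z [^] (n :: nat) \<in> M" if "z \<in> M" for z n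
    by (induction n) (use that in \<open>auto intro: M_mult M_one\<close>)
  have M_inv: "inv z \<in> M" if "z \<in> M" "z [^] n = \<one>" "n > 0" for z and n :: nat
  proof -
    have z: "z \<in> carrier P" using that by (simp add: M_def)
    have "z [^] (n - 1) \<otimes> z = \<one>"
      using that z by (simp flip: P.nat_pow_Suc)
    then have "inv z = z [^] (n - 1)"
      using z by (simp add: P.inv_equality)
    then show ?thesis using M_pow[OF that(1)] by simp
  qed
  have comm_pow: "y [^] (n :: nat) \<otimes> x = x \<otimes> y [^] n"
    if "x \<otimes> y = y \<otimes> x" "x \<in> carrier P" "y \<in> carrier P" for x y n
    using that by (intro P.group_commutes_pow) auto
  have gens_M: "a \<in> M" "b \<in> M" "c \<in> M" "d \<in> M"
  proof -
    have "a [^] i \<otimes> b [^] j \<otimes> c [^] x \<otimes> d [^] y \<otimes> g \<in> S" if g: "g \<in> {a, b, c, d}" for g and i j x y :: nat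
    proof -
      consider "g = a" | "g = b" | "g = c" | "g = d" using g by blast
      then show ?thesis
      proof cases
        case 1
        have "a [^] i \<otimes> b [^] j \<otimes> c [^] x \<otimes> d [^] y \<otimes> a = a [^] i \<otimes> b [^] j \<otimes> (c [^] x \<otimes> a) \<otimes> d [^] y"
          by (simp add: comm_pow[OF comm_gens(2)] P.m_assoc)
        also have "\<dots> = a [^] i \<otimes> (b [^] j \<otimes> a) \<otimes> c [^] (r * x) \<otimes> d [^] y"
          by (simp add: twist_pow[OF _ _ twist(1)] P.m_assoc)
        also have "\<dots> = a [^] Suc i \<otimes> b [^] j \<otimes> c [^] (r * x) \<otimes> d [^] y"
          by (simp add: comm_pow[OF comm_gens(1)] P.m_assoc)
        finally show ?thesis using 1 SI by metis
      next
        case 2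
        have "a [^] i \<otimes> b [^] j \<otimes> c [^] x \<otimes> d [^] y \<otimes> b = a [^] i \<otimes> b [^] j \<otimes> (c [^] x \<otimes> b) \<otimes> d [^] (r * y)"
          by (simp add: twist_pow[OF _ _ twist(2)] P.m_assoc)
        also have "\<dots> = a [^] i \<otimes> b [^] Suc j \<otimes> c [^] x \<otimes> d [^] (r * y)"
          by (simp add: comm_pow[OF comm_gens(3)] P.m_assoc)
        finally show ?thesis using 2 SI by metis
      next
        case 3
        have "a [^] i \<otimes> b [^] j \<otimes> c [^] x \<otimes> d [^] y \<otimes> c = a [^] i \<otimes> b [^] j \<otimes> c [^] Suc x \<otimes> d [^] y"
          by (simp add: comm_pow[OF comm_gens(4)] P.m_assoc)
        then show ?thesis using 3 SI by metis
      next
        case 4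
        have "a [^] i \<otimes> b [^] j \<otimes> c [^] x \<otimes> d [^] y \<otimes> d = a [^] i \<otimes> b [^] j \<otimes> c [^] x \<otimes> d [^] Suc y"
          by (simp add: P.m_assoc)
        then show ?thesis using 4 SI by metis
      qed
    qed
    then show "a \<in> M" "b \<in> M" "c \<in> M" "d \<in> M" by (auto simp: M_def S_def)
  qed
  have "z \<in> generate P {a, b, c, d}" using assms generated by simp
  then have "z \<in> M"
  proof (induction z rule: generate.induct)
    case (inv h)
    have "p > 0" "q > 0" using prime_p prime_q by (simp_all add: prime_gt_0_nat)
    then show ?case using inv gens_M pow_gens M_inv by blast
  qed (use gens_M M_one M_mult in auto)
  moreover have "\<one> \<in> S" using SI[of 0 0 0 0] by simp
  ultimately have "\<one> \<otimes> z \<in> S" unfolding M_def by blast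
  then show thesis using that assms by (auto simp: S_def)
qed

sublocale \<theta>: group_hom P W \<theta>
  using \<theta>_hom by unfold_locales

lemma \<theta>_normal_form:
  "\<theta> (a [^] i \<otimes> b [^] j \<otimes> c [^] x \<otimes> d [^] y) =
     T (E (int i * k) * int x) (E (int j * k) * int y) (int i * k) (int j * k)"
  by (simp add: \<theta>.hom_nat_pow \<theta>_gens T_pow_shift T_pow_translation T_mult)

lemma mult_cong_self:
  assumes "[y * x = x] (mod int p)" "\<not> [y = 1] (mod int p)"
  shows "[x = 0] (mod int p)"
proof -
  have "int p dvd (y - 1) * x" using assms(1) by (simp add: cong_iff_dvd_diff algebra_simps)
  then show ?thesis
    using assms(2) prime_p by (simp add: prime_dvd_mult_iff cong_iff_dvd_diff)
qed

lemma E_k_neq_1: "\<not> [E k = 1] (mod int p)"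
proof
  assume "[E k = 1] (mod int p)"
  then have "[E k * int r = 1 * int r] (mod int p)" by (rule cong_scalar_right)
  with E_k_r have "[int r = int 1] (mod int p)" by (metis cong_sym cong_trans mult_1 of_nat_1)
  then have "[r = 1] (mod p)" by (simp only: cong_int_iff)
  with r_neq_1 show False by contradiction
qed

lemma coprime_r: "coprime (int r) (int p)"
proof -
  have "\<not> int p dvd int r"
  proof
    assume "int p dvd int r"
    then have "int p dvd E k * int r" by simp
    with E_k_r have "int p dvd 1" by (simp add: cong_0_iff[symmetric] cong_sym_eq) (metis cong_sym cong_trans)
    then show False using p_gt_2 by auto
  qed
  then show ?thesis
    using prime_p by (simp add: prime_imp_coprime coprime_commute)
qed

lemma ord_r: "ord p r = q"
proof -
  have "ord p r dvd q" using r_pow_q ord_divides by blast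
  moreover have "ord p r \<noteq> 1" using r_neq_1 ord_divides[of r 1 p] by auto
  ultimately show ?thesis using prime_q by (auto simp: prime_nat_iff)
qed

text \<open>The image of a normal form determines its exponents modulo the orders of the generators. For \<open>i\<close> this
  uses that \<open>r\<close> has order exactly \<open>q\<close> modulo \<open>p\<close>. In particular \<open>P\<close> has the full order \<open>p\<^sup>2 q\<^sup>2\<close>.\<close>

lemma \<theta>_inj: "inj_on \<theta> (carrier P)"
  unfolding \<theta>.inj_on_one_iff
proof (intro allI impI)
  fix z assume z: "z \<in> carrier P" "\<theta> z = \<one>\<^bsub>W\<^esub>"
  obtain i j x y :: nat where nf: "z = a [^] i \<otimes> b [^] j \<otimes> c [^] x \<otimes> d [^] y"
    using normal_form z(1) .
  have *: "q dvd i" "p dvd x" if "[int i * k = 0] (mod (int p - 1))" "[E (int i * k) * int x = 0] (mod int p)" for i x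
  proof -
    show "p dvd x"
      using that(2) E_not_dvd[of "int i * k"] prime_p by (simp add: cong_0_iff prime_dvd_mult_iff)
    have "[E (int i * k) * int r ^ i = 1 * int r ^ i] (mod int p)"
      using that(1) by (intro cong_scalar_right) (simp add: E_cong_1_iff)
    with E_pow[OF E_k_r, of i] have "[int (r ^ i) = int 1] (mod int p)"
      by (metis cong_sym cong_trans mult_1 of_nat_1 of_nat_power)
    then have "[r ^ i = 1] (mod p)" by (simp only: cong_int_iff)
    then show "q dvd i" using ord_divides ord_r by metis
  qed
  have "q dvd i" "q dvd j" "p dvd x" "p dvd y"
    using z(2) by (auto simp: nf \<theta>_normal_form W_one T_eq_iff dest: *)
  moreover have "g [^] n = \<one>" if "g [^] m = \<one>" "m dvd n" "g \<in> carrier P" for g and m n :: nat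
    using that by (elim dvdE) (simp flip: P.nat_pow_pow)
  ultimately show "z = \<one>"
    using pow_gens by (simp add: nf)
qed

lemma \<theta>_image: "\<theta> ` carrier P = {T u v (i * k) (j * k) | u v i j. True}"
proof (intro equalityI subsetI)
  fix w assume "w \<in> \<theta> ` carrier P"
  then obtain z where z: "z \<in> carrier P" and w: "w = \<theta> z" by blast
  obtain i j x y :: nat where nf: "z = a [^] i \<otimes> b [^] j \<otimes> c [^] x \<otimes> d [^] y"
    using normal_form z(1) .
  show "w \<in> {T u v (i * k) (j * k) | u v i j. True}"
    unfolding w nf \<theta>_normal_form by blast
next
  fix w assume "w \<in> {T u v (i * k) (j * k) | u v i j. True}"
  then obtain u v i j where w: "w = T u v (i * k) (j * k)" by blast
  have nat_mod: "\<exists>n. int n = l mod m" if "m > 0" for l m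
    using that by (intro exI[of _ "nat (l mod m)"]) simp
  have m: "int p > 0" "int p - 1 > 0" using p_gt_2 by auto
  obtain x where x: "int x = u mod int p" using nat_mod[OF m(1)] by blast
  obtain y where y: "int y = v mod int p" using nat_mod[OF m(1)] by blast
  obtain i' where i': "int i' = i mod (int p - 1)" using nat_mod[OF m(2)] by blast
  obtain j' where j': "int j' = j mod (int p - 1)" using nat_mod[OF m(2)] by blast
  have "\<theta> (c [^] x \<otimes> d [^] y \<otimes> a [^] i' \<otimes> b [^] j') = T (int x) (int y) (int i' * k) (int j' * k)"
    by (simp add: \<theta>.hom_nat_pow \<theta>_gens T_pow_shift T_pow_translation T_mult)
  also have "\<dots> = w"
    unfolding x y i' j' w by (simp add: T_def mod_simps)
  finally have "w = \<theta> (c [^] x \<otimes> d [^] y \<otimes> a [^] i' \<otimes> b [^] j')" ..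
  then show "w \<in> \<theta> ` carrier P" by (rule image_eqI) simp
qed

text \<open>Conjugation changes the translation part arbitrarily, but the two exponents are at most
  exchanged, and the description of the image is symmetric in them.\<close>

lemma \<theta>_image_normal:
  assumes w: "w \<in> carrier W" and x: "x \<in> carrier P"
  shows "w \<otimes>\<^bsub>W\<^esub> \<theta> x \<otimes>\<^bsub>W\<^esub> inv\<^bsub>W\<^esub> w \<in> \<theta> ` carrier P"
proof -
  have T_conj: "T u v s t \<otimes>\<^bsub>W\<^esub> z \<otimes>\<^bsub>W\<^esub> inv\<^bsub>W\<^esub> T u v s t \<in> \<theta> ` carrier P" if z_im: "z \<in> \<theta> ` carrier P" for u v s t z
  proof -
    obtain u' v' i j where z: "z = T u' v' (i * k) (j * k)" using z_im unfolding \<theta>_image by blast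
    have "\<exists>u'' v''. T u v s t \<otimes>\<^bsub>W\<^esub> z \<otimes>\<^bsub>W\<^esub> inv\<^bsub>W\<^esub> T u v s t = T u'' v'' (i * k) (j * k)"
      by (simp add: z T_inv T_mult) blast
    then show ?thesis unfolding \<theta>_image by blast
  qed
  have \<sigma>_conj: "\<sigma> \<otimes>\<^bsub>W\<^esub> z \<otimes>\<^bsub>W\<^esub> inv\<^bsub>W\<^esub> \<sigma> \<in> \<theta> ` carrier P" if z_im: "z \<in> \<theta> ` carrier P" for z
  proof -
    obtain u v i j where z: "z = T u v (i * k) (j * k)" using z_im unfolding \<theta>_image by blast
    have "\<sigma> \<otimes>\<^bsub>W\<^esub> z \<otimes>\<^bsub>W\<^esub> inv\<^bsub>W\<^esub> \<sigma> = T v u (j * k) (i * k)"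
      by (simp add: z \<sigma>_T W.m_assoc)
    then show ?thesis unfolding \<theta>_image by blast
  qed
  show ?thesis
    using w
  proof (cases rule: W_cases)
    case (1 u v s t)
    then show ?thesis using T_conj x by simp
  next
    case (2 u v s t)
    have "w \<otimes>\<^bsub>W\<^esub> \<theta> x \<otimes>\<^bsub>W\<^esub> inv\<^bsub>W\<^esub> w =
        T u v s t \<otimes>\<^bsub>W\<^esub> (\<sigma> \<otimes>\<^bsub>W\<^esub> \<theta> x \<otimes>\<^bsub>W\<^esub> inv\<^bsub>W\<^esub> \<sigma>) \<otimes>\<^bsub>W\<^esub> inv\<^bsub>W\<^esub> T u v s t"
      using x by (simp add: 2 W.inv_mult_group W.m_assoc del: \<theta>.hom_inv)
    then show ?thesis using T_conj \<sigma>_conj x by simp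
  qed
qed

text \<open>Commuting with the translations forces the scalings to be trivial and rules out the exchange;
  commuting with the scalings, which have no fixed point besides the origin, then kills the
  translation part.\<close>

lemma \<theta>_centralizer:
  assumes w: "w \<in> carrier W" and comm: "\<And>x. x \<in> carrier P \<Longrightarrow> w \<otimes>\<^bsub>W\<^esub> \<theta> x = \<theta> x \<otimes>\<^bsub>W\<^esub> w"
  shows "w = \<one>\<^bsub>W\<^esub>"
  using w
proof (cases rule: W_cases)
  case (1 u v s t)
  have "[E s = 1] (mod int p)" "[E t = 1] (mod int p)"
    using comm[of c] comm[of d]
    by (simp_all add: 1 \<theta>_gens T_mult T_eq_iff cong_iff_dvd_diff)
  moreover have "[E k * u = u] (mod int p)" "[E k * v = v] (mod int p)"
    using comm[of a] comm[of b]
    by (simp_all add: 1 \<theta>_gens T_mult T_eq_iff cong_sym_eq)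
  then have "[u = 0] (mod int p)" "[v = 0] (mod int p)"
    using E_k_neq_1 by (auto intro: mult_cong_self)
  ultimately show ?thesis
    by (simp add: 1 W_one T_eq_iff E_cong_1_iff)
next
  case (2 u v s t)
  have "T u v s t \<otimes>\<^bsub>W\<^esub> T 0 1 0 0 \<otimes>\<^bsub>W\<^esub> \<sigma> = T 1 0 0 0 \<otimes>\<^bsub>W\<^esub> T u v s t \<otimes>\<^bsub>W\<^esub> \<sigma>"
    using comm[of c] by (simp add: 2 \<theta>_gens W.m_assoc \<sigma>_T)
  then have "T u v s t \<otimes>\<^bsub>W\<^esub> T 0 1 0 0 = T 1 0 0 0 \<otimes>\<^bsub>W\<^esub> T u v s t"
    by simp
  then have "int p dvd 1"
    by (simp add: T_mult T_eq_iff cong_iff_dvd_diff)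
  then show ?thesis using p_gt_2 by auto
qed

text \<open>The exponents live modulo \<open>p - 1\<close>, where \<open>p\<close> is \<open>1\<close>: an affine map with trivial \<open>p\<close>-th power is a translation.\<close>

lemma translation_if_pow_p:
  assumes "T u v s t [^]\<^bsub>W\<^esub> p = \<one>\<^bsub>W\<^esub>"
  shows "T u v s t = T u v 0 0"
proof -
  have "[s = 0] (mod (int p - 1))" if "[0 = int p * s] (mod (int p - 1))" for s
  proof -
    have "int p - 1 dvd int p * s - (int p - 1) * s" using cong_sym[OF that] by (simp add: cong_0_iff)
    then show ?thesis by (simp add: cong_0_iff algebra_simps)
  qed
  then show ?thesis
    using assms T_pow_exponents[of u v s t p] by (auto simp: W_one T_eq_iff)
qed

text \<open>The heart of the matter. The images of \<open>c\<close> and \<open>d\<close> are translations, on which the images of \<open>a\<close> and \<open>b\<close>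
  act diagonally. If the first component \<open>\<alpha>\<close> of the image of \<open>c\<close> is nonzero, the relation \<open>c a = a c^r\<close> shows that the image
  of \<open>a\<close> scales the first coordinate by \<open>E k\<close>; then \<open>d\<close>, which commutes with \<open>a\<close>, must act in the second coordinate
  alone, and the remaining commutation relations diagonalize everything. What is left is
  \<open>c \<mapsto> (\<alpha>, 0)\<close>, \<open>d \<mapsto> (0, \<delta>)\<close> and \<open>a\<close>, \<open>b\<close> mapped to scalings about a point \<open>(x, y)\<close>,
  which is the standard configuration moved by \<open>(\<alpha> X + x, \<delta> Y + y)\<close>.\<close>

lemma hom_conjugate_unswapped:
  assumes \<Theta>: "\<Theta> \<in> hom P W" and range: "\<And>x. x \<in> carrier P \<Longrightarrow> \<exists>u v s t. \<Theta> x = T u v s t"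
    and d: "\<Theta> d \<noteq> \<one>\<^bsub>W\<^esub>" and c: "\<Theta> c = T \<alpha> \<beta> 0 0" and \<alpha>: "\<not> int p dvd \<alpha>"
  shows "\<exists>w\<in>carrier W. \<forall>x\<in>carrier P. \<Theta> x \<otimes>\<^bsub>W\<^esub> w = w \<otimes>\<^bsub>W\<^esub> \<theta> x"
proof -
  interpret \<Theta>: group_hom P W \<Theta> using \<Theta> by unfold_locales
  obtain u v s t where A: "\<Theta> a = T u v s t" using range[of a] by auto
  obtain u' v' s' t' where B: "\<Theta> b = T u' v' s' t'" using range[of b] by auto
  obtain \<gamma> \<delta> where D: "\<Theta> d = T \<gamma> \<delta> 0 0"
    using range[of d] translation_if_pow_p \<Theta>.hom_nat_pow[of d p] pow_gens by (metis \<Theta>.hom_one gens_closed(4))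
  have rel: "\<Theta> c \<otimes>\<^bsub>W\<^esub> \<Theta> a = \<Theta> a \<otimes>\<^bsub>W\<^esub> \<Theta> c [^]\<^bsub>W\<^esub> r" "\<Theta> d \<otimes>\<^bsub>W\<^esub> \<Theta> b = \<Theta> b \<otimes>\<^bsub>W\<^esub> \<Theta> d [^]\<^bsub>W\<^esub> r"
    "\<Theta> a \<otimes>\<^bsub>W\<^esub> \<Theta> b = \<Theta> b \<otimes>\<^bsub>W\<^esub> \<Theta> a" "\<Theta> a \<otimes>\<^bsub>W\<^esub> \<Theta> d = \<Theta> d \<otimes>\<^bsub>W\<^esub> \<Theta> a" "\<Theta> b \<otimes>\<^bsub>W\<^esub> \<Theta> c = \<Theta> c \<otimes>\<^bsub>W\<^esub> \<Theta> b"
    using comm_gens twist by (simp_all flip: \<Theta>.hom_mult \<Theta>.hom_nat_pow)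
  have shift_is_k: "[l = k] (mod (int p - 1))" if "[E l * (int r * x) = x] (mod int p)" "\<not> int p dvd x" for l x
  proof -
    have "[E l * int r = 1] (mod int p)"
      using mult_cong_self[of "E l * int r" x] that by (auto simp: mult.assoc cong_0_iff)
    then have "[int r * E l = int r * E k] (mod int p)"
      using E_k_r by (metis cong_sym cong_trans mult.commute)
    moreover have "coprime (int r) (int p)"
      by (rule coprime_r)
    ultimately show ?thesis
      by (simp add: cong_mult_lcancel E_cong_iff)
  qed
  have shift_is_0: "[l = 0] (mod (int p - 1))" if "[E l * x = x] (mod int p)" "\<not> int p dvd x" for l x
    using mult_cong_self[of "E l" x] that by (auto simp: cong_0_iff E_cong_1_iff)
  have s: "[s = k] (mod (int p - 1))"
    using rel(1) \<alpha> by (intro shift_is_k[of s \<alpha>]) (auto simp: A c T_mult T_pow_translation T_eq_iff cong_iff_dvd_diff algebra_simps dvd_diff_commute)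
  then have Es: "[E s = E k] (mod int p)" by (simp add: E_cong_iff)
  have Es1: "\<not> [E s = 1] (mod int p)" using Es E_k_neq_1 cong_sym cong_trans by blast
  have "[E s * \<gamma> = \<gamma>] (mod int p)"
    using rel(4) by (auto simp: A D T_mult T_eq_iff cong_iff_dvd_diff algebra_simps)
  then have \<gamma>: "[\<gamma> = 0] (mod int p)" using Es1 by (rule mult_cong_self)
  have \<delta>: "\<not> int p dvd \<delta>" using d \<gamma> by (auto simp: D W_one T_eq_iff cong_0_iff)
  have t: "[t = 0] (mod (int p - 1))"
    using rel(4) \<delta> by (intro shift_is_0[of t \<delta>]) (auto simp: A D T_mult T_eq_iff cong_iff_dvd_diff algebra_simps)
  have s': "[s' = 0] (mod (int p - 1))"
    using rel(5) \<alpha> by (intro shift_is_0[of s' \<alpha>]) (auto simp: B c T_mult T_eq_iff cong_iff_dvd_diff algebra_simps)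
  have t': "[t' = k] (mod (int p - 1))"
    using rel(2) \<delta> by (intro shift_is_k[of t' \<delta>]) (auto simp: B D T_mult T_pow_translation T_eq_iff cong_iff_dvd_diff algebra_simps dvd_diff_commute)
  have A': "\<Theta> a = T u v k 0" and B': "\<Theta> b = T u' v' 0 k"
    using s t s' t' by (simp_all add: A B T_eq_iff)
  have "[E k * u' = u'] (mod int p)" "[E k * v = v] (mod int p)"
    using rel(3) by (auto simp: A' B' T_mult T_eq_iff cong_iff_dvd_diff algebra_simps dvd_diff_commute)
  then have u': "[u' = 0] (mod int p)" and v: "[v = 0] (mod int p)"
    using E_k_neq_1 by (auto intro: mult_cong_self)
  have "[int r * \<beta> = \<beta>] (mod int p)"
    using rel(1) by (auto simp: A' c T_mult T_pow_translation T_eq_iff cong_iff_dvd_diff algebra_simps dvd_diff_commute)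
  moreover have "\<not> [int r = 1] (mod int p)" using r_neq_1 cong_int_iff[of r 1 p] by simp
  ultimately have \<beta>: "[\<beta> = 0] (mod int p)" by (rule mult_cong_self)
  have A: "\<Theta> a = T u 0 k 0" and B: "\<Theta> b = T 0 v' 0 k" and C: "\<Theta> c = T \<alpha> 0 0 0" and D: "\<Theta> d = T 0 \<delta> 0 0"
    using u' v \<beta> \<gamma> by (simp_all add: A' B' c D T_eq_iff)
  \<comment> \<open>\<open>x\<close> and \<open>y\<close> are the fixed points of the affine maps \<open>X \<mapsto> u + E k * X\<close> and \<open>Y \<mapsto> v' + E k * Y\<close>.\<close>
  obtain s0 where s0: "[E s0 = \<alpha>] (mod int p)" using E_surj[OF \<alpha>] by blast
  obtain t0 where t0: "[E t0 = \<delta>] (mod int p)" using E_surj[OF \<delta>] by blast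
  have solve: "\<exists>x. [x = y + E k * x] (mod int p)" for y
  proof -
    have "coprime (1 - E k) (int p)"
      using E_k_neq_1 prime_p by (intro prime_imp_coprime[THEN coprime_commute[THEN iffD1]])
        (auto simp: cong_iff_dvd_diff dvd_diff_commute)
    then obtain z where "[(1 - E k) * z = 1] (mod int p)" using cong_solve_coprime_int by blast
    then have "[(1 - E k) * z * y = 1 * y] (mod int p)" by (rule cong_scalar_right)
    then have "[z * y = y + E k * (z * y)] (mod int p)"
      by (simp add: cong_iff_dvd_diff algebra_simps)
    then show ?thesis by blast
  qed
  obtain x where x: "[x = u + E k * x] (mod int p)" using solve by blast
  obtain y where y: "[y = v' + E k * y] (mod int p)" using solve by blast
  let ?w = "T x y s0 t0"
  define \<Theta>' where "\<Theta>' z = ?w \<otimes>\<^bsub>W\<^esub> \<theta> z \<otimes>\<^bsub>W\<^esub> inv\<^bsub>W\<^esub> ?w" for z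
  have cancel: "inv\<^bsub>W\<^esub> w \<otimes>\<^bsub>W\<^esub> (w \<otimes>\<^bsub>W\<^esub> z) = z" if "w \<in> carrier W" "z \<in> carrier W" for w z
    using that by (simp add: W.m_assoc[symmetric])
  have "\<Theta>' \<in> hom P W"
    by (rule homI) (simp_all add: \<Theta>'_def W.m_assoc cancel)
  then interpret \<Theta>': group_hom P W \<Theta>' by unfold_locales
  have gens: "\<Theta> g = \<Theta>' g" if "g \<in> {a, b, c, d}" for g
  proof -
    have "\<Theta> g \<otimes>\<^bsub>W\<^esub> ?w = ?w \<otimes>\<^bsub>W\<^esub> \<theta> g"
      using that x y cong_add[OF cong_refl s0, of x] cong_add[OF cong_refl t0, of y]
      by (auto simp: A B C D \<theta>_gens T_mult T_eq_iff add.commute intro: cong_sym)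
    then show ?thesis using that by (auto simp: \<Theta>'_def W.inv_solve_right)
  qed
  have "\<Theta> z = \<Theta>' z" if "z \<in> carrier P" for z
    using that by (elim normal_form) (simp add: \<Theta>.hom_nat_pow \<Theta>'.hom_nat_pow gens)
  then have "\<Theta> z \<otimes>\<^bsub>W\<^esub> ?w = ?w \<otimes>\<^bsub>W\<^esub> \<theta> z" if "z \<in> carrier P" for z
    using that by (simp add: \<Theta>'_def W.m_assoc)
  then show ?thesis by (intro bexI[of _ ?w]) auto
qed

text \<open>If the image of \<open>c\<close> has zero first component, then its second component is nonzero by injectivity,
  and following the automorphism by the exchange \<open>\<sigma>\<close> reduces to the previous case.\<close>

lemma auto_conjugate:
  assumes f: "f \<in> auto P"
  shows "\<exists>w\<in>carrier W. \<forall>x\<in>carrier P. \<theta> (f x) \<otimes>\<^bsub>W\<^esub> w = w \<otimes>\<^bsub>W\<^esub> \<theta> x"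
proof -
  have f_hom: "f \<in> hom P P" and f_inj: "inj_on f (carrier P)"
    using f by (auto simp: auto_def Bij_def bij_betw_def)
  interpret f: group_hom P P f using f_hom by unfold_locales
  define \<Theta> where "\<Theta> x = \<theta> (f x)" for x
  have \<Theta>_hom: "\<Theta> \<in> hom P W" by (rule homI) (simp_all add: \<Theta>_def)
  interpret \<Theta>: group_hom P W \<Theta> using \<Theta>_hom by unfold_locales
  have range: "\<exists>u v s t. \<Theta> x = T u v s t" if "x \<in> carrier P" for x
  proof -
    have "\<Theta> x \<in> \<theta> ` carrier P" using that by (simp add: \<Theta>_def)
    then show ?thesis unfolding \<theta>_image by blast
  qed
  have \<Theta>_one: "x = \<one>" if "\<Theta> x = \<one>\<^bsub>W\<^esub>" "x \<in> carrier P" for x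
    using that \<theta>_inj f_inj unfolding \<theta>.inj_on_one_iff f.inj_on_one_iff \<Theta>_def by auto
  have cd: "c \<noteq> \<one>" "d \<noteq> \<one>"
    using \<theta>_gens \<theta>.hom_one p_gt_2 by (auto simp: W_one T_eq_iff cong_def)
  obtain \<alpha> \<beta> where c: "\<Theta> c = T \<alpha> \<beta> 0 0"
    using range[of c] translation_if_pow_p \<Theta>.hom_nat_pow[of c p] pow_gens by (metis \<Theta>.hom_one gens_closed(3))
  show ?thesis
  proof (cases "int p dvd \<alpha>")
    case False
    show ?thesis
      using hom_conjugate_unswapped[OF \<Theta>_hom range _ c False] \<Theta>_one[of d] cd unfolding \<Theta>_def by auto
  next
    case True
    have "\<Theta> c \<noteq> \<one>\<^bsub>W\<^esub>" using \<Theta>_one cd by auto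
    then have \<beta>: "\<not> int p dvd \<beta>" using True by (auto simp: c W_one T_eq_iff cong_0_iff)
    define \<Theta>' where "\<Theta>' z = \<sigma> \<otimes>\<^bsub>W\<^esub> \<Theta> z \<otimes>\<^bsub>W\<^esub> \<sigma>" for z
    have cancel: "\<sigma> \<otimes>\<^bsub>W\<^esub> (\<sigma> \<otimes>\<^bsub>W\<^esub> z) = z" if "z \<in> carrier W" for z
      using that by (simp add: \<sigma>_\<sigma> flip: W.m_assoc)
    have "\<Theta>' \<in> hom P W"
      by (rule homI) (simp_all add: \<Theta>'_def W.m_assoc cancel)
    moreover have T: "\<Theta>' x = T v u t s" if "\<Theta> x = T u v s t" for x u v s t
      by (simp add: \<Theta>'_def that \<sigma>_T W.m_assoc \<sigma>_\<sigma>)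
    moreover have "\<exists>u v s t. \<Theta>' x = T u v s t" if "x \<in> carrier P" for x
      using range[OF that] T by blast
    moreover have "\<Theta>' d \<noteq> \<one>\<^bsub>W\<^esub>"
    proof
      assume *: "\<Theta>' d = \<one>\<^bsub>W\<^esub>"
      have "\<Theta> d = \<sigma> \<otimes>\<^bsub>W\<^esub> (\<Theta>' d) \<otimes>\<^bsub>W\<^esub> \<sigma>"
        by (simp add: \<Theta>'_def W.m_assoc cancel \<sigma>_\<sigma>)
      then have "\<Theta> d = \<one>\<^bsub>W\<^esub>" by (simp add: * \<sigma>_\<sigma>)
      then show False using \<Theta>_one cd by auto
    qed
    ultimately obtain w where w: "w \<in> carrier W" "\<And>x. x \<in> carrier P \<Longrightarrow> \<Theta>' x \<otimes>\<^bsub>W\<^esub> w = w \<otimes>\<^bsub>W\<^esub> \<theta> x"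
      using hom_conjugate_unswapped[of \<Theta>' \<beta> \<alpha>] \<beta> c by blast
    have "\<Theta> x \<otimes>\<^bsub>W\<^esub> (\<sigma> \<otimes>\<^bsub>W\<^esub> w) = \<sigma> \<otimes>\<^bsub>W\<^esub> w \<otimes>\<^bsub>W\<^esub> \<theta> x" if "x \<in> carrier P" for x
    proof -
      have "\<Theta> x \<otimes>\<^bsub>W\<^esub> (\<sigma> \<otimes>\<^bsub>W\<^esub> w) = \<sigma> \<otimes>\<^bsub>W\<^esub> (\<Theta>' x \<otimes>\<^bsub>W\<^esub> w)"
        using that w(1) by (simp add: \<Theta>'_def W.m_assoc cancel)
      then show ?thesis using that w by (simp add: W.m_assoc)
    qed
    then show ?thesis using w(1) unfolding \<Theta>_def by (intro bexI[of _ "\<sigma> \<otimes>\<^bsub>W\<^esub> w"]) auto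
  qed
qed

lemma AutoGroup_iso_W: "AutoGroup P \<cong> W"
  by (rule AutoGroup_iso_normalizer[OF P.is_group W.is_group \<theta>_hom \<theta>_inj \<theta>_image_normal \<theta>_centralizer auto_conjugate])

end

section \<open>Groups given by generators and relations\<close>

definition evaluate :: "('a, 'b) monoid_scheme \<Rightarrow> ('g \<Rightarrow> 'a) \<Rightarrow> 'g word \<Rightarrow> 'a" where
  "evaluate G h w = foldr (\<lambda>x y. (if snd x then h (fst x) else inv\<^bsub>G\<^esub> h (fst x)) \<otimes>\<^bsub>G\<^esub> y) w \<one>\<^bsub>G\<^esub>"

context group begin

lemma evaluate_Nil: "evaluate G h [] = \<one>"
  by (simp add: evaluate_def)

lemma evaluate_Cons: "evaluate G h (x # w) = (if snd x then h (fst x) else inv h (fst x)) \<otimes> evaluate G h w"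
  by (simp add: evaluate_def)

lemma evaluate_closed: "(\<And>x. h x \<in> carrier G) \<Longrightarrow> evaluate G h w \<in> carrier G"
  by (induction w) (auto simp: evaluate_Nil evaluate_Cons)

lemma evaluate_push:
  assumes "\<And>x. h x \<in> carrier G"
  shows "evaluate G h (push x w) = (if snd x then h (fst x) else inv h (fst x)) \<otimes> evaluate G h w"
  using assms
  by (cases w) (auto simp: evaluate_Cons evaluate_closed opposite_def m_assoc[symmetric])

lemma evaluate_hom:
  assumes "\<And>x. h x \<in> carrier G"
  shows "evaluate G h \<in> hom free_group G"
proof (rule homI)
  fix u v :: "'c word"
  have "evaluate G h (foldr push u v) = evaluate G h u \<otimes> evaluate G h v"
    by (induction u) (simp_all add: evaluate_Nil evaluate_Cons evaluate_push evaluate_closed assms m_assoc)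
  then show "evaluate G h (u \<otimes>\<^bsub>free_group\<^esub> v) = evaluate G h u \<otimes> evaluate G h v"
    by (simp add: free_group_def)
qed (simp add: evaluate_closed assms)

lemma evaluate_free_gen: "h x \<in> carrier G \<Longrightarrow> evaluate G h (free_gen x) = h x"
  by (simp add: free_gen_def evaluate_def)

text \<open>A homomorphism from the free group is determined by its values on the generators, which gives that
  the classes of the generators generate a presented group.\<close>

lemma free_group_hom_eq_evaluate:
  assumes f: "f \<in> hom free_group G" and w: "w \<in> carrier free_group"
  shows "f w = evaluate G (\<lambda>x. f (free_gen x)) w"
proof -
  interpret F: group "free_group :: 'c word monoid" by (rule group_free_group)
  interpret f: group_hom free_group G f using f by unfold_locales
  have inv_gen: "inv\<^bsub>free_group\<^esub> free_gen x = [(x, False)]" for x :: 'c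
    by (rule F.inv_equality) (auto simp: free_group_def free_gen_def reduced_def opposite_def)
  have "reduced w \<Longrightarrow> ?thesis"
  proof (induction w)
    case Nil
    have "f [] = \<one>" using f.hom_one by (simp add: free_group_def)
    then show ?case by (simp add: evaluate_Nil)
  next
    case (Cons x w)
    then have w: "reduced w" by (auto dest: reduced_ConsD)
    have "x # w = [x] \<otimes>\<^bsub>free_group\<^esub> w"
      using Cons.prems by (cases w) (auto simp: free_group_def reduced_def)
    moreover have "[x] = (if snd x then free_gen (fst x) else inv\<^bsub>free_group\<^esub> free_gen (fst x))"
      using inv_gen[of "fst x"] by (cases x) (auto simp: free_gen_def)
    moreover have "w \<in> carrier free_group" using w by (simp add: free_group_def)
    ultimately have "f (x # w) = (if snd x then f (free_gen (fst x)) else inv f (free_gen (fst x))) \<otimes> f w"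
      by (simp add: free_gen_closed)
    then show ?case using Cons.IH w by (simp add: evaluate_Cons)
  qed
  then show ?thesis using w by (simp add: free_group_def)
qed

end
definition relator_class :: "('g word \<times> 'g word) set \<Rightarrow> 'g word \<Rightarrow> 'g word set" where
  "relator_class E w = normal_closure free_group {u \<otimes>\<^bsub>free_group\<^esub> inv\<^bsub>free_group\<^esub> v | u v. (u, v) \<in> E} #>\<^bsub>free_group\<^esub> w"

context
  fixes E :: "('g word \<times> 'g word) set"
  assumes E: "E \<subseteq> carrier free_group \<times> carrier free_group"
begin

interpretation F: group "free_group :: 'g word monoid" by (rule group_free_group)

lemma relators_closed: "{u \<otimes>\<^bsub>free_group\<^esub> inv\<^bsub>free_group\<^esub> v | u v. (u, v) \<in> E} \<subseteq> carrier free_group"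
  using E by fastforce

lemma relator_class_hom: "relator_class E \<in> hom free_group (presented_group E)"
  unfolding relator_class_def presented_group_def
  by (rule normal.r_coset_hom_Mod[OF normal_normal_closure[OF group_free_group relators_closed]])

lemma carrier_presented_group: "carrier (presented_group E) = relator_class E ` carrier free_group"
  by (auto simp: presented_group_def relator_class_def FactGroup_def RCOSETS_def)

lemma relator_class_eq:
  assumes "(u, v) \<in> E"
  shows "relator_class E u = relator_class E v"
proof -
  let ?N = "normal_closure free_group {u \<otimes>\<^bsub>free_group\<^esub> inv\<^bsub>free_group\<^esub> v | u v. (u, v) \<in> E}"
  have uv: "u \<in> carrier free_group" "v \<in> carrier free_group" using assms E by auto
  interpret N: normal ?N free_group by (rule normal_normal_closure[OF group_free_group relators_closed])
  have "u \<otimes>\<^bsub>free_group\<^esub> inv\<^bsub>free_group\<^esub> v \<in> ?N"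
    using assms by (auto simp: normal_closure_def)
  then have "u \<in> ?N #>\<^bsub>free_group\<^esub> v"
    using uv by (simp add: N.rcos_module)
  then show ?thesis
    unfolding relator_class_def using uv N.subgroup_axioms by (intro F.repr_independence[symmetric])
qed

lemma presented_group_universal:
  assumes h: "h \<in> hom free_group H" and H: "group H"
    and rel: "\<And>u v. (u, v) \<in> E \<Longrightarrow> h u = h v"
  obtains g where "g \<in> hom (presented_group E) H" "\<And>w. w \<in> carrier free_group \<Longrightarrow> g (relator_class E w) = h w"
proof -
  interpret H: group H by fact
  interpret h: group_hom free_group H h using h by unfold_locales
  let ?N = "normal_closure free_group {u \<otimes>\<^bsub>free_group\<^esub> inv\<^bsub>free_group\<^esub> v | u v. (u, v) \<in> E}"
  have "h (u \<otimes>\<^bsub>free_group\<^esub> inv\<^bsub>free_group\<^esub> v) = \<one>\<^bsub>H\<^esub>" if "(u, v) \<in> E" for u v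
    using rel[OF that] that E by auto
  then have "?N \<subseteq> kernel free_group H h"
  proof -
    assume one: "\<And>u v. (u, v) \<in> E \<Longrightarrow> h (u \<otimes>\<^bsub>free_group\<^esub> inv\<^bsub>free_group\<^esub> v) = \<one>\<^bsub>H\<^esub>"
    have "{u \<otimes>\<^bsub>free_group\<^esub> inv\<^bsub>free_group\<^esub> v | u v. (u, v) \<in> E} \<subseteq> kernel free_group H h"
      using relators_closed one unfolding kernel_def by blast
    then show ?thesis
      using h.normal_kernel unfolding normal_closure_def by (intro Inter_lower) simp
  qed
  then obtain g where "g \<in> hom (free_group Mod ?N) H"
    "\<And>x. x \<in> carrier free_group \<Longrightarrow> g (?N #>\<^bsub>free_group\<^esub> x) = h x"
    using h.FactGroup_universal_kernel[OF normal_normal_closure[OF group_free_group relators_closed]] by blast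
  then show thesis
    by (intro that) (simp_all add: presented_group_def relator_class_def)
qed

lemma presented_group_generated:
  "carrier (presented_group E) = generate (presented_group E) (range (\<lambda>x. relator_class E (free_gen x)))"
proof -
  interpret P: group "presented_group E" by (rule group_presented_group[OF E])
  let ?gens = "range (\<lambda>x. relator_class E (free_gen x))"
  have gens: "?gens \<subseteq> carrier (presented_group E)"
    by (auto simp: carrier_presented_group free_gen_closed)
  have "evaluate (presented_group E) h w \<in> generate (presented_group E) ?gens" if "range h = ?gens" for w and h :: "'g \<Rightarrow> _"
  proof -
    have h: "h x \<in> generate (presented_group E) ?gens" "inv\<^bsub>presented_group E\<^esub> h x \<in> generate (presented_group E) ?gens" for x
      using that rangeI[of h x] by (auto intro: generate.incl generate.inv)
    show ?thesis
      by (induction w) (auto simp: P.evaluate_Nil P.evaluate_Cons intro: generate.one generate.eng h)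
  qed
  then show ?thesis
    using P.generate_incl[OF gens] P.free_group_hom_eq_evaluate[OF relator_class_hom]
    by (auto simp: carrier_presented_group)
qed

end

lemma (in group) commutator_eq_one_iff:
  assumes "x \<in> carrier G" "y \<in> carrier G"
  shows "commutator G x y = \<one> \<longleftrightarrow> x \<otimes> y = y \<otimes> x"
proof -
  have "commutator G x y = inv (y \<otimes> x) \<otimes> (x \<otimes> y)"
    using assms by (simp add: commutator_def inv_mult_group m_assoc)
  then show ?thesis
    using assms by (simp add: inv_solve_left')
qed

lemma (in group_hom) hom_commutator:
  assumes "x \<in> carrier G" "y \<in> carrier G"
  shows "h (commutator G x y) = commutator H (h x) (h y)"
  using assms by (simp add: commutator_def)

section \<open>The automorphism group\<close>

lemma relations_closed: "relations p q r \<subseteq> carrier free_group \<times> carrier free_group"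
proof -
  interpret F: group "free_group :: gen word monoid" by (rule group_free_group)
  show ?thesis
    by (auto simp: relations_def Let_def free_gen_closed commutator_def)
qed

lemma relations_hold_iff:
  fixes H (structure)
  assumes h: "group_hom free_group H h"
  shows "(\<forall>(u, v)\<in>relations p q r. h u = h v) \<longleftrightarrow>
    (let a = h (free_gen GenA); b = h (free_gen GenB); c = h (free_gen GenC); d = h (free_gen GenD)
     in a [^]\<^bsub>H\<^esub> q = \<one>\<^bsub>H\<^esub> \<and> b [^]\<^bsub>H\<^esub> q = \<one>\<^bsub>H\<^esub> \<and> c [^]\<^bsub>H\<^esub> p = \<one>\<^bsub>H\<^esub> \<and> d [^]\<^bsub>H\<^esub> p = \<one>\<^bsub>H\<^esub> \<and>
        a \<otimes>\<^bsub>H\<^esub> b = b \<otimes>\<^bsub>H\<^esub> a \<and> a \<otimes>\<^bsub>H\<^esub> d = d \<otimes>\<^bsub>H\<^esub> a \<and> b \<otimes>\<^bsub>H\<^esub> c = c \<otimes>\<^bsub>H\<^esub> b \<and> c \<otimes>\<^bsub>H\<^esub> d = d \<otimes>\<^bsub>H\<^esub> c \<and>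
        c \<otimes>\<^bsub>H\<^esub> a = a \<otimes>\<^bsub>H\<^esub> c [^]\<^bsub>H\<^esub> r \<and> d \<otimes>\<^bsub>H\<^esub> b = b \<otimes>\<^bsub>H\<^esub> d [^]\<^bsub>H\<^esub> r)"
proof -
  interpret h: group_hom free_group H h by (rule h)
  have conj: "inv\<^bsub>H\<^esub> x \<otimes>\<^bsub>H\<^esub> y \<otimes>\<^bsub>H\<^esub> x = z \<longleftrightarrow> y \<otimes>\<^bsub>H\<^esub> x = x \<otimes>\<^bsub>H\<^esub> z"
    if "x \<in> carrier H" "y \<in> carrier H" "z \<in> carrier H" for x y z
    using that by (simp add: h.H.m_assoc h.H.inv_solve_left')
  show ?thesis
    unfolding relations_def Let_def
    by (simp add: free_gen_closed h.hom_nat_pow h.hom_int_pow h.hom_commutator h.H.commutator_eq_one_iff conj)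
qed

lemma (in group) int_pow_eq_nat_pow_mod:
  assumes "x \<in> carrier G" "x [^] (n :: nat) = \<one>" "n > 0"
  shows "x [^] (i :: int) = x [^] nat (i mod int n)"
proof -
  have "x [^] i = x [^] (int n * (i div int n) + i mod int n)" by simp
  also have "\<dots> = (x [^] int n) [^] (i div int n) \<otimes> x [^] (i mod int n)"
    using assms(1) by (simp only: int_pow_mult int_pow_pow)
  also have "x [^] int n = \<one>" using assms(2) by (simp add: int_pow_int)
  also have "x [^] (i mod int n) = x [^] nat (i mod int n)"
    using assms by (simp add: int_pow_def2)
  finally show ?thesis using assms(1) by simp
qed

theorem mainTheorem17:
  fixes p q :: nat and r :: int
  assumes "prime p" and "prime q" and "p \<noteq> q" and "p * q \<noteq> 6" and "q dvd p - 1"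
    and "[r ^ q = 1] (mod int p)" and "\<not> [r = 1] (mod int p)"
  shows "\<exists>\<psi> \<phi>.
    \<psi> \<in> hom (integer_mod_group 2)
           (AutoGroup (integer_mod_group (p - 1) \<times>\<times> integer_mod_group (p - 1))) \<and>
    \<phi> \<in> hom (semidirect (integer_mod_group (p - 1) \<times>\<times> integer_mod_group (p - 1))
                         (integer_mod_group 2) \<psi>)
           (AutoGroup (integer_mod_group p \<times>\<times> integer_mod_group p)) \<and>
    AutoGroup (presented_group (relations p q r)) \<cong>
      semidirect (integer_mod_group p \<times>\<times> integer_mod_group p)
        (semidirect (integer_mod_group (p - 1) \<times>\<times> integer_mod_group (p - 1))
                    (integer_mod_group 2) \<psi>) \<phi>"
proof -
  have p_gt_2: "p > 2"
  proof -
    have "q \<le> p - 1" using assms(1,5) prime_gt_1_nat[of p] by (intro dvd_imp_le) auto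
    then show ?thesis using prime_ge_2_nat[OF assms(2)] by linarith
  qed
  obtain E where "discrete_exponential p E"
    using exists_discrete_exponential[OF assms(1) p_gt_2] by blast
  then interpret discrete_exponential p E .

  have "coprime r (int p)"
  proof (rule ccontr)
    assume "\<not> coprime r (int p)"
    then have "int p dvd r"
      using assms(1) prime_imp_coprime[of "int p" r] by (auto simp: coprime_commute)
    then have "[r ^ q = 0] (mod int p)"
      using prime_gt_0_nat[OF assms(2)] dvd_trans[OF _ dvd_power[of q r]] by (simp add: cong_0_iff)
    with assms(6) have "[1 = 0] (mod int p)" by (metis cong_sym cong_trans)
    then show False using p_gt_2 by (simp add: cong_0_iff)
  qed
  then obtain r' where r': "[r * r' = 1] (mod int p)" using cong_solve_coprime_int by blast
  have "\<not> int p dvd r'"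
  proof
    assume "int p dvd r'"
    then have "int p dvd r * r'" by simp
    with r' have "[1 = 0] (mod int p)" by (metis cong_0_iff cong_sym cong_trans)
    then show False using p_gt_2 by (simp add: cong_0_iff)
  qed
  then obtain k where k: "[E k = r'] (mod int p)" using E_surj by blast
  have E_k_r: "[E k * r = 1] (mod int p)"
    using cong_trans[OF cong_scalar_right[OF k, of r]] r' by (simp add: mult.commute)

  \<comment> \<open>The relations hold for the images of the generators in \<open>W\<close>, so the presented group maps to \<open>W\<close>.\<close>
  define rels where "rels = relations p q r"
  have closed: "rels \<subseteq> carrier free_group \<times> carrier free_group"
    unfolding rels_def by (rule relations_closed)
  define P where "P = presented_group rels"
  interpret P: group P unfolding P_def by (rule group_presented_group[OF closed])
  define \<kappa> where "\<kappa> = relator_class rels"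
  interpret \<kappa>: group_hom free_group P \<kappa>
    unfolding P_def \<kappa>_def
    using relator_class_hom[OF closed] group_free_group group_presented_group[OF closed]
    by (simp add: group_hom_def group_hom_axioms_def)
  define img where "img = case_gen (T 0 0 k 0) (T 0 0 0 k) (T 1 0 0 0) (T 0 1 0 0)"
  have img_closed: "img x \<in> carrier W" for x by (cases x) (auto simp: img_def)
  interpret ev: group_hom free_group W "evaluate W img"
    using W.evaluate_hom[of img] img_closed group_free_group
    by (simp add: group_hom_def group_hom_axioms_def W.is_group)
  have ev_gen: "evaluate W img (free_gen x) = img x" for x
    by (rule W.evaluate_free_gen) (rule img_closed)
  have "[int q * k = 0] (mod (int p - 1))"
  proof -
    have "[E (int q * k) * r ^ q = E (int q * k) * 1] (mod int p)"
      using assms(6) by (rule cong_scalar_left)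
    then have "[E (int q * k) = 1] (mod int p)"
      using E_pow[OF E_k_r, of q] by (metis cong_sym cong_trans mult.right_neutral)
    then show ?thesis by (simp only: E_cong_1_iff)
  qed
  then have "\<forall>(u, v)\<in>rels. evaluate W img u = evaluate W img v"
    unfolding rels_def relations_hold_iff[OF ev.group_hom_axioms] ev_gen Let_def
    using E_k_r
    by (simp add: img_def T_pow_shift T_pow_translation T_int_pow_translation T_mult W_one T_eq_iff cong_0_iff cong_sym_eq[of 1])
  then obtain \<theta> where \<theta>: "\<theta> \<in> hom P W" and \<theta>_\<kappa>: "\<And>w. w \<in> carrier free_group \<Longrightarrow> \<theta> (\<kappa> w) = evaluate W img w"
    using presented_group_universal[OF closed ev.homh W.is_group] unfolding P_def \<kappa>_def by blast

  have gens_closed: "\<kappa> (free_gen x) \<in> carrier P" for x by (simp add: free_gen_closed)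
  have "\<forall>(u, v)\<in>rels. \<kappa> u = \<kappa> v"
    unfolding \<kappa>_def using relator_class_eq[OF closed] by blast
  note rels = this[unfolded rels_def relations_hold_iff[OF \<kappa>.group_hom_axioms] Let_def]
  have \<theta>_gen: "\<theta> (\<kappa> (free_gen x)) = img x" for x
    using \<theta>_\<kappa>[OF free_gen_closed] ev_gen by simp
  have img: "img GenA = T 0 0 k 0" "img GenB = T 0 0 0 k" "img GenC = T 1 0 0 0" "img GenD = T 0 1 0 0"
    by (simp_all add: img_def)
  \<comment> \<open>\<open>r\<close> may be negative; since \<open>c\<close> and \<open>d\<close> have order dividing \<open>p\<close>, its residue serves as a natural exponent.\<close>
  define R where "R = nat (r mod int p)"
  have R: "int R = r mod int p" using p_gt_2 by (simp add: R_def)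
  have pow_R: "x [^]\<^bsub>P\<^esub> R = x [^]\<^bsub>P\<^esub> r" if "x \<in> carrier P" "x [^]\<^bsub>P\<^esub> p = \<one>\<^bsub>P\<^esub>" for x
    unfolding R_def using P.int_pow_eq_nat_pow_mod[OF that] p_gt_2 by simp
  have "[int R = r] (mod int p)" by (simp add: R)
  have "embedded_square p E P q R k (\<kappa> (free_gen GenA)) (\<kappa> (free_gen GenB)) (\<kappa> (free_gen GenC)) (\<kappa> (free_gen GenD)) \<theta>"
  proof
    show "prime q" by fact
    have "[int (R ^ q) = int 1] (mod int p)"
      using assms(6) cong_pow[OF \<open>[int R = r] (mod int p)\<close>, of q] by (auto intro: cong_trans)
    then show "[R ^ q = 1] (mod p)" by (simp only: cong_int_iff)
    show "\<not> [R = 1] (mod p)"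
    proof
      assume "[R = 1] (mod p)"
      then have "[int R = int 1] (mod int p)" by (simp only: cong_int_iff)
      then show False using assms(7) \<open>[int R = r] (mod int p)\<close> by (metis cong_sym cong_trans of_nat_1)
    qed
    show "[E k * int R = 1] (mod int p)"
      using cong_trans[OF cong_scalar_left[OF \<open>[int R = r] (mod int p)\<close>] E_k_r] .
    have "range (\<lambda>x. \<kappa> (free_gen x)) = {\<kappa> (free_gen GenA), \<kappa> (free_gen GenB), \<kappa> (free_gen GenC), \<kappa> (free_gen GenD)}"
      by (auto simp: image_iff) (metis gen.exhaust)+
    then show "carrier P = generate P {\<kappa> (free_gen GenA), \<kappa> (free_gen GenB), \<kappa> (free_gen GenC), \<kappa> (free_gen GenD)}"
      using presented_group_generated[OF closed] unfolding P_def \<kappa>_def by simp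
  qed (use rels gens_closed \<theta> in \<open>simp_all add: \<theta>_gen img pow_R\<close>)
  then have "AutoGroup P \<cong> W" by (rule embedded_square.AutoGroup_iso_W)
  then show ?thesis
    using exchange_hom scale_hom
    unfolding P_def rels_def W_def monomials_def exponents_def shifts_def by blast
qed

end
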